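(* Let $a,b,c\geq0$ be integers and $N=a+2b+c$. Let $M\in M_N(\{0,1\})$ be an $(a,b,c)$ pattern. Let $P$ be the $0/1$ matrix marking the positions of the $0$ entries of $M$, and let $Q=M$ mark the positions of the $1$ entries. For $x,y\in\mathbb C$ set $U(x,y)=xP+yQ$. Consider the matrices $U(x,y)$ satisfying all of the following: $y>0$; $U(x,y)$ is unitary with all entries nonzero; $U(x,y)$ is a critical point of $\|V\|_1=\sum_{i,j}|V_{ij}|$ on $U(N)$. These matrices are precisely those of the following two kinds. (1) Real solutions: $x=-\frac{t}{\sqrt b(t+1)}$ and $y=\frac{1}{\sqrt b(t+1)}$, where $t>0$ satisfies $at^2-2bt+c=0$. (2) Complex solutions: $y=\frac1{\sqrt N}$ and $x=-\frac{\varepsilon}{\sqrt N}$, where $\varepsilon\in\mathbb C$, $|\varepsilon|=1$, satisfies $2b\,\mathrm{Re}(\varepsilon)=a+c$. Moreover, a matrix can be both a real and a complex solution only when $a+c=2b=\frac N2$ and $U(-1,1)$ is an Hadamard matrix. In that case the common solution is $U(-1,1)/\sqrt N$.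
   Context: An $(a,b,c)$ pattern, with $N=a+2b+c$, is a matrix $M\in M_N(\{0,1\})$ with the following property. For any two distinct rows, after a permutation of the columns, there are $a$ columns where both rows have $0$, $b$ columns where the first has $0$ and the second has $1$, $b$ columns where the first has $1$ and the second has $0$, and $c$ columns where both have $1$. For $U\in U(N)$ with all entries nonzero, "critical point of $\|\cdot\|_1$ on $U(N)$" means critical point of the smooth function $V\mapsto\sum_{i,j}|V_{ij}|$ restricted to the manifold $U(N)$ near $U$. This is equivalent to $S^*U$ being self-adjoint, where $S_{ij}=U_{ij}/|U_{ij}|$.
   Formalization: The formal theorem assumes N ≥ 2: for N = 1 (b = 0, a + c = 1) the pattern condition is vacuous and the claim fails, since M = (1) gives the critical unitary U = (1) while neither kind of solution exists; for N = 0 the formulas are undefined. *)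

theory Defs
  imports "HOL-Analysis.Analysis"
begin

definition column_count :: "nat^'n^'n \<Rightarrow> 'n \<Rightarrow> 'n \<Rightarrow> nat \<Rightarrow> nat \<Rightarrow> nat" where
  "column_count M i j u v = card {k. M $ i $ k = u \<and> M $ j $ k = v}"

text \<open>
  Permuting the columns into blocks amounts to prescribing how often each pair of values
  occurs. For a 1x1 matrix the condition on rows is vacuous.
\<close>

definition is_pattern :: "nat \<Rightarrow> nat \<Rightarrow> nat \<Rightarrow> nat^'n^'n \<Rightarrow> bool" where
  "is_pattern a b c M \<longleftrightarrow>
     CARD('n) = a + 2 * b + c \<and>
     (\<forall>i j. M $ i $ j \<in> {0, 1}) \<and>
     (\<forall>i j. i \<noteq> j \<longrightarrow>
        column_count M i j 0 0 = a \<and> column_count M i j 0 1 = b \<and>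
        column_count M i j 1 0 = b \<and> column_count M i j 1 1 = c)"

definition position_matrix :: "nat \<Rightarrow> nat^'n^'n \<Rightarrow> complex^'n^'n" where
  "position_matrix u M = (\<chi> i j. if M $ i $ j = u then 1 else 0)"

definition pattern_matrix :: "nat^'n^'n \<Rightarrow> complex \<Rightarrow> complex \<Rightarrow> complex^'n^'n" where
  "pattern_matrix M x y =
     (\<chi> i j. x * position_matrix 0 M $ i $ j + y * position_matrix 1 M $ i $ j)"

definition conj_transpose :: "complex^'n^'m \<Rightarrow> complex^'m^'n" where
  "conj_transpose A = (\<chi> i j. cnj (A $ j $ i))"

definition unitary_group :: "(complex^'n^'n) set" where
  "unitary_group = {A. A ** conj_transpose A = mat 1 \<and> conj_transpose A ** A = mat 1}"

definition one_norm :: "complex^'n^'n \<Rightarrow> real" where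
  "one_norm V = (\<Sum>i\<in>UNIV. \<Sum>j\<in>UNIV. cmod (V $ i $ j))"

text \<open>
  Critical points of the restriction of \<open>f\<close> to a submanifold \<open>S\<close>: the differential vanishes
  on the tangent space at \<open>p\<close>, which consists of the velocities at \<open>p\<close> of curves in \<open>S\<close>.
  Meaningful when \<open>f\<close> is differentiable at \<open>p\<close>; for \<open>one_norm\<close> this is the case when
  all entries of \<open>p\<close> are nonzero.
\<close>

definition critical_point_on ::
    "('a::real_normed_vector \<Rightarrow> real) \<Rightarrow> 'a set \<Rightarrow> 'a \<Rightarrow> bool" where
  "critical_point_on f S p \<longleftrightarrow>
     p \<in> S \<and>
     (\<forall>e>0. \<forall>\<gamma>::real \<Rightarrow> 'a.
        \<gamma> C1_differentiable_on {-e<..<e} \<and> \<gamma> ` {-e<..<e} \<subseteq> S \<and> \<gamma> 0 = p \<longrightarrow>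
        ((\<lambda>s. f (\<gamma> s)) has_real_derivative 0) (at 0))"

definition real_solutions :: "nat \<Rightarrow> nat \<Rightarrow> nat \<Rightarrow> nat^'n^'n \<Rightarrow> (complex^'n^'n) set" where
  "real_solutions a b c M =
     {pattern_matrix M (of_real (- (t / (sqrt (real b) * (t + 1)))))
                       (of_real (1 / (sqrt (real b) * (t + 1)))) | t::real.
        t > 0 \<and> real a * t\<^sup>2 - 2 * real b * t + real c = 0}"

definition complex_solutions :: "nat \<Rightarrow> nat \<Rightarrow> nat \<Rightarrow> nat^'n^'n \<Rightarrow> (complex^'n^'n) set" where
  "complex_solutions a b c M =
     {pattern_matrix M (- (\<epsilon> / of_real (sqrt (real (a + 2 * b + c)))))
                       (of_real (1 / sqrt (real (a + 2 * b + c)))) | \<epsilon>::complex.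
        cmod \<epsilon> = 1 \<and> 2 * real b * Re \<epsilon> = real a + real c}"

definition hadamard_matrix :: "complex^'n^'n \<Rightarrow> bool" where
  "hadamard_matrix H \<longleftrightarrow>
     (\<forall>i j. H $ i $ j \<in> {1, -1}) \<and>
     (\<forall>i j. i \<noteq> j \<longrightarrow> (\<Sum>k\<in>UNIV. H $ i $ k * H $ j $ k) = 0)"

end

theory Submission
  imports Defs
begin

text \<open>
  Write \<open>S\<close> for the entrywise phase of \<open>U\<close>. The derivative of the one-norm along a curve with
  velocity \<open>A\<close> is \<open>Re (tr (S\<^sup>* A))\<close>, and the tangent vectors at \<open>U\<close> are \<open>U B\<close> with \<open>B\<close>
  skew-Hermitian, so \<open>U\<close> is critical iff \<open>S\<^sup>* U\<close> is Hermitian. For \<open>U = x P + y Q\<close> with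
  \<open>w = x / |x|\<close> this says \<open>(|x| - y) (w P\<^sup>T Q - cnj w Q\<^sup>T P)\<^sub>k\<^sub>l = 0\<close> for all \<open>k\<close>, \<open>l\<close>. If \<open>|x| \<noteq> y\<close>, then,
  since the columns of \<open>U\<close> have norm one, all columns of \<open>M\<close> have the same weight, hence
  \<open>P\<^sup>T Q = Q\<^sup>T P \<noteq> 0\<close> and the condition reduces to \<open>x\<close> being real. Thus \<open>U\<close> is critical iff
  \<open>|x| = y\<close> or \<open>x\<close> is real; the orthonormality relations of the rows, which are
  \<open>(a + b) |x|\<^sup>2 + (b + c) y\<^sup>2 = 1\<close> and \<open>a |x|\<^sup>2 + 2 b y Re x + c y\<^sup>2 = 0\<close>, then give the two families.
\<close>

section \<open>Matrices\<close>

lemma conj_transpose_nth [simp]: "conj_transpose A $ i $ j = cnj (A $ j $ i)"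
  by (simp add: conj_transpose_def)

lemma conj_transpose_mult: "conj_transpose (A ** B) = conj_transpose B ** conj_transpose A"
  by (simp add: vec_eq_iff matrix_matrix_mult_def mult.commute)

lemma trace_conj_transpose: "trace (conj_transpose A) = cnj (trace A)"
  by (simp add: trace_def)

lemma trace_minus: "trace (- A :: complex^'n^'n) = - trace A"
  by (simp add: trace_def sum_negf)

text \<open>A right inverse of a square matrix is also a left inverse, so orthonormal rows
  suffice.\<close>

lemma unitary_group_iff_rows:
  "U \<in> unitary_group \<longleftrightarrow>
     (\<forall>i j. (\<Sum>k\<in>UNIV. U $ i $ k * cnj (U $ j $ k)) = (if i = j then 1 else 0))"
proof -
  have "U \<in> unitary_group \<longleftrightarrow> U ** conj_transpose U = mat 1"
    using matrix_left_right_inverse[of U "conj_transpose U"] by (auto simp: unitary_group_def)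
  then show ?thesis
    by (simp add: vec_eq_iff matrix_matrix_mult_def mat_def)
qed

lemma unitary_group_columns:
  assumes "U \<in> unitary_group"
  shows "(\<Sum>k\<in>UNIV. cnj (U $ k $ i) * U $ k $ j) = (if i = j then 1 else 0)"
proof -
  have "(conj_transpose U ** U) $ i $ j = mat 1 $ i $ j"
    using assms by (simp add: unitary_group_def)
  then show ?thesis
    by (simp add: matrix_matrix_mult_def mat_def)
qed

text \<open>The adjoint of \<open>H ** B\<close> is \<open>- (B ** H)\<close>, which has the same
  trace as \<open>- (H ** B)\<close>. So the conjugate of the trace is its negative, and the trace
  is purely imaginary.\<close>

lemma Re_trace_hermitian_skew:
  assumes "conj_transpose H = H" and "conj_transpose B = - B"
  shows "Re (trace (H ** B)) = 0"
proof -
  have "cnj (trace (H ** B)) = trace ((- B) ** H)"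
    by (metis assms conj_transpose_mult trace_conj_transpose)
  also have "(- B) ** H = - (B ** H)"
    by (simp add: vec_eq_iff matrix_matrix_mult_def sum_negf)
  also have "trace (- (B ** H)) = - trace (H ** B)"
    by (metis trace_minus trace_mul_sym)
  finally show ?thesis
    by (simp add: complex_eq_iff)
qed

section \<open>Critical points of the one-norm\<close>

definition sgn_matrix :: "complex^'n^'n \<Rightarrow> complex^'n^'n" where
  "sgn_matrix U = (\<chi> i j. sgn (U $ i $ j))"

lemma has_vector_derivative_vec_nth:
  "(f has_vector_derivative f') F \<Longrightarrow> ((\<lambda>s. f s $ i) has_vector_derivative f' $ i) F"
  by (rule bounded_linear.has_vector_derivative[OF bounded_linear_vec_nth])

text \<open>Away from 0 the modulus is differentiable with gradient \<open>sgn w\<close> for the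
  real inner product \<open>Re (cnj w * z)\<close>; summing over all entries yields the
  trace.\<close>

lemma has_real_derivative_one_norm:
  fixes \<gamma> :: "real \<Rightarrow> complex^'n^'n"
  assumes \<gamma>: "(\<gamma> has_vector_derivative A) (at t)"
    and nz: "\<And>i j. \<gamma> t $ i $ j \<noteq> 0"
  shows "((\<lambda>s. one_norm (\<gamma> s)) has_real_derivative
           Re (trace (conj_transpose (sgn_matrix (\<gamma> t)) ** A))) (at t)"
proof -
  have 1: "((\<lambda>s. cmod (\<gamma> s $ i $ j)) has_real_derivative
          Re (cnj (sgn (\<gamma> t $ i $ j)) * A $ i $ j)) (at t)" for i j
  proof -
    have "((\<lambda>s. \<gamma> s $ i $ j) has_derivative (\<lambda>h. h *\<^sub>R A $ i $ j)) (at t)"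
      using has_vector_derivative_vec_nth[OF has_vector_derivative_vec_nth[OF \<gamma>]]
      by (simp add: has_vector_derivative_def)
    from has_derivative_compose[OF this has_derivative_norm[OF nz]]
    show ?thesis
      by (auto simp: has_field_derivative_def inner_complex_def algebra_simps fun_eq_iff
          elim!: has_derivative_eq_rhs)
  qed
  have "((\<lambda>s. one_norm (\<gamma> s)) has_real_derivative
      (\<Sum>i\<in>UNIV. \<Sum>j\<in>UNIV. Re (cnj (sgn (\<gamma> t $ i $ j)) * A $ i $ j))) (at t)"
    unfolding one_norm_def by (intro DERIV_sum 1)
  moreover have "(\<Sum>i\<in>UNIV. \<Sum>j\<in>UNIV. Re (cnj (sgn (\<gamma> t $ i $ j)) * A $ i $ j))
      = Re (trace (conj_transpose (sgn_matrix (\<gamma> t)) ** A))"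
    by (subst sum.swap) (simp add: trace_def matrix_matrix_mult_def sgn_matrix_def)
  ultimately show ?thesis by simp
qed

text \<open>The inner products of the columns are constant along the curve near \<open>t\<close>, so
  by the product rule \<open>conj_transpose (\<gamma> t) ** A\<close> and its adjoint add up to
  zero.\<close>

lemma unitary_curve_tangent_skew:
  fixes \<gamma> :: "real \<Rightarrow> complex^'n^'n"
  assumes \<gamma>: "(\<gamma> has_vector_derivative A) (at t)"
    and S: "open S" "t \<in> S" "\<gamma> ` S \<subseteq> unitary_group"
  shows "conj_transpose (conj_transpose (\<gamma> t) ** A) = - (conj_transpose (\<gamma> t) ** A)"
proof -
  have "(\<Sum>k\<in>UNIV. cnj (A $ k $ i) * \<gamma> t $ k $ j + cnj (\<gamma> t $ k $ i) * A $ k $ j) = 0" for i j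
  proof -
    note d = has_vector_derivative_vec_nth[OF has_vector_derivative_vec_nth[OF \<gamma>]]
    have "((\<lambda>s. \<Sum>k\<in>UNIV. cnj (\<gamma> s $ k $ i) * \<gamma> s $ k $ j) has_vector_derivative
        (\<Sum>k\<in>UNIV. cnj (\<gamma> t $ k $ i) * A $ k $ j + cnj (A $ k $ i) * \<gamma> t $ k $ j)) (at t)"
      by (intro has_vector_derivative_sum has_vector_derivative_mult has_vector_derivative_cnj d)
    moreover have "((\<lambda>s. \<Sum>k\<in>UNIV. cnj (\<gamma> s $ k $ i) * \<gamma> s $ k $ j) has_vector_derivative 0) (at t)"
      by (rule has_vector_derivative_transform_within_open[OF _ S(1,2),
            where f = "\<lambda>_. if i = j then 1 else 0"])
         (use S(3) unitary_group_columns in \<open>fastforce+\<close>)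
    ultimately show ?thesis
      by (simp add: vector_derivative_unique_at add.commute)
  qed
  then show ?thesis
    by (simp add: vec_eq_iff matrix_matrix_mult_def sum.distrib eq_neg_iff_add_eq_0 mult.commute)
qed

lemma critical_point_one_norm_if_hermitian:
  fixes U :: "complex^'n^'n"
  assumes U: "U \<in> unitary_group" and nz: "\<And>i j. U $ i $ j \<noteq> 0"
    and herm: "conj_transpose (conj_transpose (sgn_matrix U) ** U) = conj_transpose (sgn_matrix U) ** U"
  shows "critical_point_on one_norm unitary_group U"
  unfolding critical_point_on_def
proof (intro conjI U allI impI, elim conjE)
  fix e :: real and \<gamma> :: "real \<Rightarrow> complex^'n^'n"
  assume e: "e > 0" and C1: "\<gamma> C1_differentiable_on {-e<..<e}"
    and sub: "\<gamma> ` {-e<..<e} \<subseteq> unitary_group" and 0: "\<gamma> 0 = U"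
  obtain A where A: "(\<gamma> has_vector_derivative A) (at 0)"
    using C1 e by (force simp: C1_differentiable_on_def)
  let ?S = "conj_transpose (sgn_matrix U)" and ?B = "conj_transpose U ** A"
  have "conj_transpose ?B = - ?B"
    using unitary_curve_tangent_skew[OF A open_greaterThanLessThan _ sub] e 0 by simp
  then have "Re (trace (?S ** U ** ?B)) = 0"
    by (rule Re_trace_hermitian_skew[OF herm])
  \<comment> \<open>Inserting \<open>U ** conj_transpose U = mat 1\<close> exhibits the derivative
    as the trace of a Hermitian matrix times a skew-Hermitian one.\<close>
  moreover have "?S ** U ** ?B = ?S ** (U ** conj_transpose U) ** A"
    by (simp only: matrix_mul_assoc)
  then have "?S ** U ** ?B = ?S ** A"
    using U by (simp add: unitary_group_def)
  ultimately show "((\<lambda>s. one_norm (\<gamma> s)) has_real_derivative 0) (at 0)"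
    using has_real_derivative_one_norm[OF A] nz 0 by simp
qed

lemma sum_remove2:
  fixes f :: "'n::finite \<Rightarrow> 'a::comm_monoid_add"
  assumes "k \<noteq> l"
  shows "sum f UNIV = f k + f l + sum f (UNIV - {k, l})"
  using assms sum.subset_diff[of "{k, l}" UNIV f] by (simp add: add.commute)

text \<open>Rotating the columns \<open>k\<close> and \<open>l\<close> into each other with phase \<open>z\<close> gives enough test curves:
  \<open>z = 1\<close> and \<open>z = \<i>\<close> show that \<open>S\<^sup>* U\<close> is Hermitian at position \<open>(l, k)\<close>.\<close>

lemma critical_point_one_norm_rotation:
  fixes U :: "complex^'n^'n"
  assumes crit: "critical_point_on one_norm unitary_group U"
    and nz: "\<And>i j. U $ i $ j \<noteq> 0" and "k \<noteq> l" and z: "cmod z = 1"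
  defines "H \<equiv> conj_transpose (sgn_matrix U) ** U"
  shows "Re (z * (H $ l $ k - cnj (H $ k $ l))) = 0"
proof -
  \<comment> \<open>\<open>A\<close> keeps the columns other than \<open>k\<close> and
    \<open>l\<close>, \<open>B\<close> holds these two, and \<open>C\<close> is \<open>U\<close>
    times the skew-Hermitian generator of the rotation. The curve
    \<open>A + cos s B + sin s C\<close> thus starts at \<open>U\<close> with velocity
    \<open>C\<close>.\<close>
  define A B C :: "complex^'n^'n" where
    "A = (\<chi> i j. if j \<in> {k, l} then 0 else U $ i $ j)"
    and "B = (\<chi> i j. if j \<in> {k, l} then U $ i $ j else 0)"
    and "C = (\<chi> i j. if j = k then - cnj z * U $ i $ l else if j = l then z * U $ i $ k else 0)"
  define \<gamma> where "\<gamma> s = A + cos s *\<^sub>R B + sin s *\<^sub>R C" for s :: real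
  define \<gamma>' where "\<gamma>' s = - sin s *\<^sub>R B + cos s *\<^sub>R C" for s :: real
  have D: "(\<gamma> has_vector_derivative \<gamma>' s) (at s)" for s
    unfolding \<gamma>_def \<gamma>'_def by (auto intro!: derivative_eq_intros)
  have C1: "\<gamma> C1_differentiable_on {-1<..<1}"
    unfolding C1_differentiable_on_def
  proof (intro exI[of _ \<gamma>'] conjI ballI D)
    show "continuous_on {-1<..<1} \<gamma>'"
      unfolding \<gamma>'_def by (intro continuous_intros)
  qed
  have 0: "\<gamma> 0 = U"
    by (simp add: \<gamma>_def A_def B_def vec_eq_iff)
  have U: "U \<in> unitary_group"
    using crit by (simp add: critical_point_on_def)
  have "\<gamma> s \<in> unitary_group" for s
  proof -
    define p q where "p = complex_of_real (cos s)" and "q = complex_of_real (sin s)"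
    have pq: "p * p + q * q = 1"
      unfolding p_def q_def of_real_mult[symmetric] of_real_add[symmetric]
      by (simp flip: power2_eq_square)
    have zz: "z * cnj z = 1"
      using z by (simp add: complex_norm_square[symmetric])
    have k: "\<gamma> s $ i $ k = p * U $ i $ k - q * cnj z * U $ i $ l"
      and l: "\<gamma> s $ i $ l = p * U $ i $ l + q * z * U $ i $ k" for i
      using \<open>k \<noteq> l\<close> by (auto simp: \<gamma>_def A_def B_def C_def p_def q_def)
       (simp_all add: scaleR_conv_of_real)
    have cnj_pq: "cnj p = p" "cnj q = q"
      by (simp_all add: p_def q_def)
    have "(\<Sum>m\<in>UNIV. \<gamma> s $ i $ m * cnj (\<gamma> s $ j $ m)) = (\<Sum>m\<in>UNIV. U $ i $ m * cnj (U $ j $ m))"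
      for i j
    proof -
      have "(\<Sum>m\<in>UNIV - {k, l}. \<gamma> s $ i $ m * cnj (\<gamma> s $ j $ m))
          = (\<Sum>m\<in>UNIV - {k, l}. U $ i $ m * cnj (U $ j $ m))"
        by (rule sum.cong) (auto simp: \<gamma>_def A_def B_def C_def)
      \<comment> \<open>Only the entries in columns \<open>k\<close> and \<open>l\<close> move, and
        they are rotated by a unitary 2x2 matrix, so their share of the inner product of two rows is
        preserved.\<close>
      moreover have "\<gamma> s $ i $ k * cnj (\<gamma> s $ j $ k) + \<gamma> s $ i $ l * cnj (\<gamma> s $ j $ l)
          = U $ i $ k * cnj (U $ j $ k) + U $ i $ l * cnj (U $ j $ l)"
        unfolding k l complex_cnj_mult complex_cnj_add complex_cnj_diff complex_cnj_cnj cnj_pq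
        using pq zz by algebra
      ultimately show ?thesis
        by (simp add: sum_remove2[OF \<open>k \<noteq> l\<close>])
    qed
    then show ?thesis
      using U by (simp add: unitary_group_iff_rows)
  qed
  then have "((\<lambda>s. one_norm (\<gamma> s)) has_real_derivative 0) (at 0)"
    using crit C1 0 unfolding critical_point_on_def
    by (auto dest!: spec[of _ "1::real"] spec[of _ \<gamma>])
  moreover have "((\<lambda>s. one_norm (\<gamma> s)) has_real_derivative
      Re (trace (conj_transpose (sgn_matrix U) ** C))) (at 0)"
    using has_real_derivative_one_norm[OF D[of 0]] nz 0 by (simp add: \<gamma>'_def)
  ultimately have "Re (trace (conj_transpose (sgn_matrix U) ** C)) = 0"
    using DERIV_unique by blast
  \<comment> \<open>\<open>C\<close> vanishes outside columns \<open>k\<close> and \<open>l\<close>,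
    and each of these is a multiple of the other column of \<open>U\<close>; hence just two
    off-diagonal entries of \<open>H\<close> survive.\<close>
  moreover have "trace (conj_transpose (sgn_matrix U) ** C) = - cnj z * H $ k $ l + z * H $ l $ k"
  proof -
    let ?S = "conj_transpose (sgn_matrix U)"
    have "(?S ** C) $ k $ k = - cnj z * H $ k $ l" "(?S ** C) $ l $ l = z * H $ l $ k"
      using \<open>k \<noteq> l\<close>
      by (simp_all add: H_def matrix_matrix_mult_def C_def sum_distrib_left mult.left_commute sum_negf)
    moreover have "(\<Sum>m\<in>UNIV - {k, l}. (?S ** C) $ m $ m) = 0"
      by (rule sum.neutral) (simp add: matrix_matrix_mult_def C_def)
    ultimately show ?thesis
      by (simp add: trace_def sum_remove2[OF \<open>k \<noteq> l\<close>])
  qed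
  \<comment> \<open>Conjugation does not change real parts, so \<open>cnj z * H $ k $ l\<close> may
    be replaced by \<open>z * cnj (H $ k $ l)\<close>.\<close>
  ultimately show ?thesis
    by (simp add: algebra_simps)
qed

lemma hermitian_if_critical_point_one_norm:
  fixes U :: "complex^'n^'n"
  assumes crit: "critical_point_on one_norm unitary_group U"
    and nz: "\<And>i j. U $ i $ j \<noteq> 0"
  shows "conj_transpose (conj_transpose (sgn_matrix U) ** U) = conj_transpose (sgn_matrix U) ** U"
proof -
  define H where "H = conj_transpose (sgn_matrix U) ** U"
  have "cnj (H $ k $ l) = H $ l $ k" for k l
  proof (cases "k = l")
    case True
    \<comment> \<open>The diagonal needs no test curve: its entries are sums of moduli, hence
      real.\<close>
    have "cnj (sgn w) * w = of_real (cmod w)" for w :: complex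
      by (cases "w = 0")
         (simp_all add: sgn_eq complex_norm_square[symmetric] mult.commute power2_eq_square)
    then show ?thesis
      using True by (simp add: H_def matrix_matrix_mult_def sgn_matrix_def)
  next
    case False
    from critical_point_one_norm_rotation[OF crit nz False, of 1]
         critical_point_one_norm_rotation[OF crit nz False, of \<i>]
    show ?thesis
      by (simp add: H_def complex_eq_iff)
  qed
  then show ?thesis
    by (simp add: H_def[symmetric] vec_eq_iff)
qed

theorem critical_point_one_norm_iff:
  assumes "U \<in> unitary_group" and "\<And>i j. U $ i $ j \<noteq> 0"
  shows "critical_point_on one_norm unitary_group U \<longleftrightarrow>
    conj_transpose (conj_transpose (sgn_matrix U) ** U) = conj_transpose (sgn_matrix U) ** U"
  using assms critical_point_one_norm_if_hermitian hermitian_if_critical_point_one_norm by blast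

section \<open>Pattern matrices\<close>

text \<open>Reduces inner products of two rows to four counts. Applied to
  \<open>transpose M\<close>, it treats pairs of columns in the same way.\<close>

lemma sum_column_count:
  fixes f :: "nat \<Rightarrow> nat \<Rightarrow> 'a::semiring_1"
  assumes "\<And>i j. M $ i $ j \<in> {0, 1}"
  shows "(\<Sum>k\<in>UNIV. f (M $ i $ k) (M $ j $ k)) =
    of_nat (column_count M i j 0 0) * f 0 0 + of_nat (column_count M i j 0 1) * f 0 1 +
    of_nat (column_count M i j 1 0) * f 1 0 + of_nat (column_count M i j 1 1) * f 1 1"
proof -
  define g where "g u v k = (if M $ i $ k = u \<and> M $ j $ k = v then f u v else 0)" for u v k
  have "(\<Sum>k\<in>UNIV. g u v k) = of_nat (column_count M i j u v) * f u v" for u v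
    by (simp add: g_def sum.If_cases column_count_def)
  moreover have "f (M $ i $ k) (M $ j $ k) = g 0 0 k + g 0 1 k + g 1 0 k + g 1 1 k" for k
    using assms[of i k] assms[of j k] by (auto simp: g_def)
  ultimately show ?thesis
    by (simp add: sum.distrib)
qed

text \<open>Pairing row \<open>i\<close> with itself counts its zeros and ones; splitting these by
  the entries of row \<open>j\<close> gets the weight of a single row out of counts for a
  pair.\<close>

lemma column_count_diag:
  assumes "\<And>i j. M $ i $ j \<in> {0, 1}"
  shows "column_count M i i 0 0 = column_count M i j 0 0 + column_count M i j 0 1"
    and "column_count M i i 1 1 = column_count M i j 1 0 + column_count M i j 1 1"
    and "column_count M i i 0 1 = 0" and "column_count M i i 1 0 = 0"
proof -
  have "column_count M i i u u =
      card ({k. M $ i $ k = u \<and> M $ j $ k = 0} \<union> {k. M $ i $ k = u \<and> M $ j $ k = 1})"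
    for u
    unfolding column_count_def using assms[of j] by (auto intro: arg_cong[where f = card])
  then have "column_count M i i u u = column_count M i j u 0 + column_count M i j u 1" for u
    by (subst (asm) card_Un_disjoint) (auto simp: column_count_def)
  then show "column_count M i i 0 0 = column_count M i j 0 0 + column_count M i j 0 1"
    and "column_count M i i 1 1 = column_count M i j 1 0 + column_count M i j 1 1"
    by simp_all
qed (auto simp: column_count_def)

lemma column_count_commute: "column_count M i j u v = column_count M j i v u"
  by (simp add: column_count_def conj_commute)

lemma ex_distinct_index:
  assumes "CARD('n::finite) \<ge> 2"
  shows "\<exists>i j :: 'n. i \<noteq> j"
  using assms card_le_Suc0_iff_eq[of "UNIV :: 'n set"] by auto

section \<open>Unitarity of pattern matrices in terms of \<open>x\<close> and
  \<open>y\<close>\<close>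

lemma is_pattern_entries: "is_pattern a b c M \<Longrightarrow> M $ i $ j \<in> {0, 1}"
  by (simp add: is_pattern_def)

lemma pattern_matrix_nth:
  assumes "is_pattern a b c M"
  shows "pattern_matrix M x y $ i $ j = (if M $ i $ j = 0 then x else y)"
  using is_pattern_entries[OF assms, of i j]
  by (auto simp: pattern_matrix_def position_matrix_def)

lemma pattern_matrix_rows:
  fixes M :: "nat^'n^'n"
  assumes M: "is_pattern a b c M" and card: "CARD('n) \<ge> 2"
  shows "(\<Sum>k\<in>UNIV. pattern_matrix M x y $ i $ k * cnj (pattern_matrix M x y $ j $ k)) =
    (if i = j then of_real ((real a + real b) * (cmod x)\<^sup>2 + (real b + real c) * (cmod y)\<^sup>2)
     else of_real (real a * (cmod x)\<^sup>2 + 2 * real b * Re (x * cnj y) + real c * (cmod y)\<^sup>2))"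
proof -
  note e = is_pattern_entries[OF M]
  define g where "g u = (if u = (0::nat) then x else y)" for u
  have U: "(\<Sum>k\<in>UNIV. pattern_matrix M x y $ i $ k * cnj (pattern_matrix M x y $ j $ k)) =
      (\<Sum>k\<in>UNIV. g (M $ i $ k) * cnj (g (M $ j $ k)))"
    by (simp add: pattern_matrix_nth[OF M] g_def)
  note cc = sum_column_count[OF e, where f = "\<lambda>u v. g u * cnj (g v)"]
  show ?thesis
  proof (cases "i = j")
    case True
    \<comment> \<open>The pattern condition speaks only of distinct rows, so the weight of row
      \<open>i\<close> is read off from a comparison with a second row.\<close>
    obtain j' where j': "j' \<noteq> i"
      using ex_distinct_index[OF card] by metis
    then have "column_count M i i 0 0 = a + b" "column_count M i i 1 1 = b + c"
      using M column_count_diag(1,2)[OF e, of i j'] by (auto simp: is_pattern_def)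
    with True show ?thesis
      using column_count_diag(3,4)[OF e, of i]
      unfolding U cc by (simp add: g_def complex_norm_square[symmetric] del: One_nat_def)
  next
    case False
    then have "column_count M i j 0 0 = a" "column_count M i j 0 1 = b"
      "column_count M i j 1 0 = b" "column_count M i j 1 1 = c"
      using M by (auto simp: is_pattern_def)
    moreover have "of_real (2 * real b * Re (x * cnj y)) = of_nat b * (x * cnj y) + of_nat b * (y * cnj x)"
      using arg_cong[OF complex_add_cnj[of "x * cnj y"], of "\<lambda>z. of_nat b * z"]
      by (simp add: algebra_simps del: times_complex.sel)
    ultimately show ?thesis
      using False unfolding U cc
      by (simp add: g_def complex_norm_square[symmetric] algebra_simps
          del: One_nat_def times_complex.sel)
  qed
qed

lemma pattern_matrix_unitary_iff:
  fixes M :: "nat^'n^'n"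
  assumes M: "is_pattern a b c M" and card: "CARD('n) \<ge> 2"
  shows "pattern_matrix M x (of_real y) \<in> unitary_group \<longleftrightarrow>
    (real a + real b) * (cmod x)\<^sup>2 + (real b + real c) * y\<^sup>2 = 1 \<and>
    real a * (cmod x)\<^sup>2 + 2 * real b * (y * Re x) + real c * y\<^sup>2 = 0"
proof -
  obtain i j :: 'n where "i \<noteq> j"
    using ex_distinct_index[OF card] by blast
  have eq: "complex_of_real r = 1 \<longleftrightarrow> r = 1" "complex_of_real r = 0 \<longleftrightarrow> r = 0" for r
    by simp_all
  show ?thesis
    unfolding unitary_group_iff_rows pattern_matrix_rows[OF M card]
    using \<open>i \<noteq> j\<close> by (auto simp: eq mult.commute simp del: of_real_add of_real_mult of_real_power)
qed

section \<open>Column counts and the Hermitian condition\<close>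

lemma pattern_matrix_columns:
  assumes M: "is_pattern a b c M" and U: "pattern_matrix M x (of_real y) \<in> unitary_group"
  shows "real (column_count (transpose M) k k 0 0) * (cmod x)\<^sup>2 +
    real (column_count (transpose M) k k 1 1) * y\<^sup>2 = 1"
proof -
  define g where "g u = (if u = (0::nat) then x else of_real y)" for u
  have e: "transpose M $ i $ j \<in> {0, 1}" for i j
    using is_pattern_entries[OF M] by (simp add: transpose_def)
  have "(\<Sum>i\<in>UNIV. cnj (g (transpose M $ k $ i)) * g (transpose M $ k $ i)) = 1"
    using unitary_group_columns[OF U, of k k]
    by (simp add: pattern_matrix_nth[OF M] g_def transpose_def)
  then have "complex_of_real (real (column_count (transpose M) k k 0 0) * (cmod x)\<^sup>2 +
      real (column_count (transpose M) k k 1 1) * y\<^sup>2) = of_real 1"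
    using sum_column_count[OF e, where f = "\<lambda>u v. cnj (g u) * g v" and i = k and j = k]
    by (simp add: g_def column_count_diag(3,4)[OF e] complex_norm_square[symmetric] power2_eq_square
        mult.commute del: One_nat_def)
  then show ?thesis
    by (simp only: of_real_eq_iff)
qed

text \<open>The pattern condition constrains rows only; information on columns comes from unitarity.
  Subtracting the unit-length equations of columns \<open>k\<close> and \<open>l\<close> leaves the
  difference of the two mixed counts times \<open>(cmod x)\<^sup>2 - y\<^sup>2\<close>, whose second
  factor is nonzero.\<close>

lemma pattern_matrix_column_balance:
  assumes M: "is_pattern a b c M" and U: "pattern_matrix M x (of_real y) \<in> unitary_group"
    and "y > 0" "cmod x \<noteq> y"
  shows "column_count (transpose M) k l 0 1 = column_count (transpose M) k l 1 0"
proof -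
  let ?n = "\<lambda>u v. real (column_count (transpose M) k l u v)"
  have e: "transpose M $ i $ j \<in> {0, 1}" for i j
    using is_pattern_entries[OF M] by (simp add: transpose_def)
  have "(?n 0 0 + ?n 0 1) * (cmod x)\<^sup>2 + (?n 1 0 + ?n 1 1) * y\<^sup>2 = 1"
    using pattern_matrix_columns[OF M U, of k] column_count_diag(1,2)[OF e, of k l] by simp
  moreover have "(?n 0 0 + ?n 1 0) * (cmod x)\<^sup>2 + (?n 0 1 + ?n 1 1) * y\<^sup>2 = 1"
    using pattern_matrix_columns[OF M U, of l] column_count_diag(1,2)[OF e, of l k]
    by (simp add: column_count_commute[of _ l k])
  ultimately have "(?n 0 1 - ?n 1 0) * ((cmod x)\<^sup>2 - y\<^sup>2) = 0"
    by (simp add: algebra_simps)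
  moreover have "(cmod x)\<^sup>2 \<noteq> y\<^sup>2"
    using assms by (simp add: power2_eq_iff_nonneg)
  ultimately show ?thesis by simp
qed

text \<open>The contribution of a row to the defect \<open>H $ l $ k - cnj (H $ k $ l)\<close>
  depends only on its entries in columns \<open>k\<close> and \<open>l\<close>. Equal entries
  contribute nothing, and the two mixed cases contribute \<open>(cmod x - y) * sgn x\<close> and
  \<open>- (cmod x - y) * cnj (sgn x)\<close>.\<close>

lemma pattern_matrix_hermitian_iff:
  fixes M :: "nat^'n^'n" and x :: complex
  assumes M: "is_pattern a b c M" and "y > 0"
  defines "U \<equiv> pattern_matrix M x (of_real y)"
  shows "conj_transpose (conj_transpose (sgn_matrix U) ** U) = conj_transpose (sgn_matrix U) ** U
    \<longleftrightarrow> (\<forall>k l. of_real (cmod x - y) *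
          (of_nat (column_count (transpose M) k l 0 1) * sgn x -
           of_nat (column_count (transpose M) k l 1 0) * cnj (sgn x)) = 0)"
proof -
  define H where "H = conj_transpose (sgn_matrix U) ** U"
  define g where "g u = (if u = (0::nat) then x else of_real y)" for u
  have e: "transpose M $ i $ j \<in> {0, 1}" for i j
    using is_pattern_entries[OF M] by (simp add: transpose_def)
  have "H $ l $ k - cnj (H $ k $ l) = of_real (cmod x - y) *
          (of_nat (column_count (transpose M) k l 0 1) * sgn x -
           of_nat (column_count (transpose M) k l 1 0) * cnj (sgn x))" (is "_ = ?r") for k l
  proof -
    define f where "f u v = cnj (sgn (g v)) * g u - sgn (g u) * cnj (g v)" for u v
    have "sgn (complex_of_real y) = 1"
      using \<open>y > 0\<close> by (simp add: sgn_of_real)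
    \<comment> \<open>The case \<open>x = 0\<close> is consistent because
      \<open>sgn 0 = 0\<close>.\<close>
    then have f_values: "f 0 0 = 0" "f 0 1 = of_real (cmod x - y) * sgn x"
      "f 1 0 = - of_real (cmod x - y) * cnj (sgn x)" "f 1 1 = 0"
      by (cases "x = 0"; simp add: f_def g_def sgn_eq field_simps)+
    have f: "(\<Sum>i\<in>UNIV. f (transpose M $ k $ i) (transpose M $ l $ i)) = ?r"
      unfolding sum_column_count[OF e, of f] f_values by (simp add: algebra_simps)
    have "H $ l $ k - cnj (H $ k $ l) = (\<Sum>i\<in>UNIV. f (transpose M $ k $ i) (transpose M $ l $ i))"
      by (simp add: H_def U_def matrix_matrix_mult_def sgn_matrix_def pattern_matrix_nth[OF M]
          sum_subtractf f_def g_def transpose_def)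
    also note f
    finally show ?thesis .
  qed
  then have "H $ l $ k = cnj (H $ k $ l) \<longleftrightarrow> of_real (cmod x - y) *
          (of_nat (column_count (transpose M) k l 0 1) * sgn x -
           of_nat (column_count (transpose M) k l 1 0) * cnj (sgn x)) = 0" for k l
    by (metis eq_iff_diff_eq_0)
  moreover have "conj_transpose H = H \<longleftrightarrow> (\<forall>k l. H $ l $ k = cnj (H $ k $ l))"
    unfolding vec_eq_iff conj_transpose_nth by metis
  ultimately show ?thesis
    by (simp add: H_def)
qed

text \<open>Ensures that both parameters really occur as entries of a pattern matrix, so that they
  can be recovered from it and nonzero entries force \<open>x\<close> to be nonzero.\<close>

lemma pattern_mixed_row:
  fixes M :: "nat^'n^'n"
  assumes M: "is_pattern a b c M" and card: "CARD('n) \<ge> 2" and "b > 0"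
  obtains i k l where "M $ i $ k = 0" "M $ i $ l = 1"
proof -
  obtain i j :: 'n where "i \<noteq> j"
    using ex_distinct_index[OF card] by blast
  then have "column_count M i j 0 1 \<noteq> 0" "column_count M i j 1 0 \<noteq> 0"
    using M \<open>b > 0\<close> by (auto simp: is_pattern_def)
  then have "{k. M $ i $ k = 0 \<and> M $ j $ k = 1} \<noteq> {}" "{k. M $ i $ k = 1 \<and> M $ j $ k = 0} \<noteq> {}"
    unfolding column_count_def by (metis card.empty)+
  then show thesis
    using that by blast
qed

lemma pattern_matrix_eq_iff:
  fixes M :: "nat^'n^'n"
  assumes M: "is_pattern a b c M" and card: "CARD('n) \<ge> 2" and "b > 0"
  shows "pattern_matrix M x y = pattern_matrix M x' y' \<longleftrightarrow> x = x' \<and> y = y'"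
proof -
  obtain i k l where "M $ i $ k = 0" "M $ i $ l = 1"
    using pattern_mixed_row[OF assms] .
  then show ?thesis
    by (metis pattern_matrix_nth[OF M] zero_neq_one)
qed

lemma pattern_matrix_critical_iff:
  fixes M :: "nat^'n^'n"
  assumes M: "is_pattern a b c M" and card: "CARD('n) \<ge> 2" and "y > 0"
  defines "U \<equiv> \<lambda>x. pattern_matrix M x (of_real y)"
  shows "U x \<in> unitary_group \<and> (\<forall>i j. U x $ i $ j \<noteq> 0) \<and>
      critical_point_on one_norm unitary_group (U x) \<longleftrightarrow>
    b > 0 \<and> x \<noteq> 0 \<and> (cmod x = y \<or> Im x = 0) \<and>
    (real a + real b) * (cmod x)\<^sup>2 + (real b + real c) * y\<^sup>2 = 1 \<and>
    real a * (cmod x)\<^sup>2 + 2 * real b * (y * Re x) + real c * y\<^sup>2 = 0"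
    (is "?L \<longleftrightarrow> _ \<and> _ \<and> _ \<and> ?diag \<and> ?off")
proof (cases "?diag \<and> ?off")
  case True
  then have unit: "U x \<in> unitary_group"
    using pattern_matrix_unitary_iff[OF M card] by (simp add: U_def)
  \<comment> \<open>For \<open>b = 0\<close> the two orthonormality relations have the same
    left-hand side but the values 1 and 0.\<close>
  have "b \<noteq> 0"
  proof
    assume "b = 0"
    then have "real a * (cmod x)\<^sup>2 + real c * y\<^sup>2 = 0" "real a * (cmod x)\<^sup>2 + real c * y\<^sup>2 = 1"
      using True by auto
    then show False by linarith
  qed
  then have "b > 0" by simp
  obtain i k l where ikl: "M $ i $ k = 0" "M $ i $ l = 1"
    using pattern_mixed_row[OF M card \<open>b > 0\<close>] .
  have nz: "(\<forall>i j. U x $ i $ j \<noteq> 0) \<longleftrightarrow> x \<noteq> 0"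
    using ikl \<open>y > 0\<close> by (auto simp: U_def pattern_matrix_nth[OF M])
  have "critical_point_on one_norm unitary_group (U x) \<longleftrightarrow> cmod x = y \<or> Im x = 0" if "x \<noteq> 0"
  proof -
    let ?p = "\<lambda>k l. column_count (transpose M) k l 0 1"
    let ?q = "\<lambda>k l. column_count (transpose M) k l 1 0"
    have "critical_point_on one_norm unitary_group (U x) \<longleftrightarrow> (\<forall>k l. of_real (cmod x - y) *
        (of_nat (?p k l) * sgn x - of_nat (?q k l) * cnj (sgn x)) = 0)"
      using critical_point_one_norm_iff[OF unit] nz that
        pattern_matrix_hermitian_iff[OF M \<open>y > 0\<close>, of x] by (simp add: U_def)
    also have "\<dots> \<longleftrightarrow> cmod x = y \<or> (\<forall>k l. of_nat (?p k l) * sgn x = of_nat (?q k l) * cnj (sgn x))"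
      by (auto simp flip: of_real_diff)
    also have "\<dots> \<longleftrightarrow> cmod x = y \<or> Im x = 0"
    proof (cases "cmod x = y")
      case False
      have pq: "?p k l = ?q k l" for k l
        using pattern_matrix_column_balance[OF M _ \<open>y > 0\<close> False] unit by (simp add: U_def)
      \<comment> \<open>The mixed row witnesses that the count for this pair of columns is positive.
        As the two mixed counts agree, it cancels and leaves
        \<open>sgn x = cnj (sgn x)\<close>.\<close>
      have "i \<in> {m. transpose M $ k $ m = 0 \<and> transpose M $ l $ m = 1}"
        using ikl by (simp add: transpose_def)
      then have "?p k l \<noteq> 0"
        unfolding column_count_def by (metis card_0_eq empty_iff finite)
      then have "(\<forall>k l. of_nat (?p k l) * sgn x = of_nat (?q k l) * cnj (sgn x)) \<longleftrightarrow> sgn x = cnj (sgn x)"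
        unfolding pq[symmetric] by auto
      also have "\<dots> \<longleftrightarrow> Im x = 0"
        using that by (auto simp: sgn_eq complex_eq_iff)
      finally show ?thesis
        using False by simp
    qed simp
    finally show ?thesis .
  qed
  with nz unit True \<open>b > 0\<close> show ?thesis
    by blast
next
  case False
  then show ?thesis
    using pattern_matrix_unitary_iff[OF M card] by (auto simp: U_def)
qed

section \<open>Classification of the critical pattern matrices\<close>

theorem theorem5p2:
  fixes a b c N :: nat and M :: "nat^'n^'n"
  assumes "N = a + 2 * b + c"
    and "CARD('n) = N"
    and "N \<ge> 2"
    and "is_pattern a b c M"
  shows "{pattern_matrix M x (of_real y) | (x::complex) (y::real).
            y > 0 \<and>
            pattern_matrix M x (of_real y) \<in> unitary_group \<and>
            (\<forall>i j. pattern_matrix M x (of_real y) $ i $ j \<noteq> 0) \<and>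
            critical_point_on one_norm unitary_group (pattern_matrix M x (of_real y))}
         = real_solutions a b c M \<union> complex_solutions a b c M
    \<and> (real_solutions a b c M \<inter> complex_solutions a b c M \<noteq> {} \<longrightarrow>
         a + c = 2 * b \<and> 2 * real b = real N / 2 \<and> hadamard_matrix (pattern_matrix M (-1) 1))
    \<and> (a + c = 2 * b \<and> 2 * real b = real N / 2 \<and> hadamard_matrix (pattern_matrix M (-1) 1) \<longrightarrow>
         real_solutions a b c M \<inter> complex_solutions a b c M
           = {(1 / sqrt (real N)) *\<^sub>R pattern_matrix M (-1) 1})"
    (is "?crit = _ \<and> _ \<and> _")
proof (intro conjI)
  note M = \<open>is_pattern a b c M\<close>
  have card: "CARD('n) \<ge> 2" and N: "real N = real a + 2 * real b + real c"
    using assms(1-3) by simp_all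
  have "N > 0"
    using \<open>N \<ge> 2\<close> by linarith
  let ?U = "\<lambda>x y. pattern_matrix M x (complex_of_real y)"
  have crit_iff: "U \<in> ?crit \<longleftrightarrow> (\<exists>x y. U = ?U x y \<and> y > 0 \<and>
      b > 0 \<and> x \<noteq> 0 \<and> (cmod x = y \<or> Im x = 0) \<and>
      (real a + real b) * (cmod x)\<^sup>2 + (real b + real c) * y\<^sup>2 = 1 \<and>
      real a * (cmod x)\<^sup>2 + 2 * real b * (y * Re x) + real c * y\<^sup>2 = 0)" for U
    using pattern_matrix_critical_iff[OF M card] by blast
  \<comment> \<open>In either family \<open>b = 0\<close> would force \<open>a = c = 0\<close> and
    hence \<open>N = 0\<close>; so the divisor \<open>sqrt (real b)\<close> is never zero for an
    actual solution.\<close>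
  have b_pos_real: "b > 0" if "t > 0" "real a * t\<^sup>2 - 2 * real b * t + real c = 0" for t
  proof (rule ccontr)
    assume "\<not> b > 0"
    then have "real a * t\<^sup>2 + real c = 0" "N = a + c"
      using that assms(1) by simp_all
    then show False
      using \<open>t > 0\<close> \<open>N > 0\<close> by (simp add: add_nonneg_eq_0_iff)
  qed
  have b_pos_complex: "b > 0" if "2 * real b * r = real a + real c" for r
    using that \<open>N > 0\<close> assms(1) by (cases "b = 0") auto

  \<comment> \<open>The critical points are the union of the two families\<close>
  show "?crit = real_solutions a b c M \<union> complex_solutions a b c M"
  proof (intro set_eqI iffI)
    fix U assume "U \<in> ?crit"
    then obtain x y where U: "U = ?U x y" and "y > 0" "b > 0" "x \<noteq> 0"
      and x: "cmod x = y \<or> Im x = 0"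
      and diag: "(real a + real b) * (cmod x)\<^sup>2 + (real b + real c) * y\<^sup>2 = 1"
      and off: "real a * (cmod x)\<^sup>2 + 2 * real b * (y * Re x) + real c * y\<^sup>2 = 0"
      using crit_iff by blast
    show "U \<in> real_solutions a b c M \<union> complex_solutions a b c M"
    proof (cases "cmod x = y")
      case True
      \<comment> \<open>With \<open>cmod x = y\<close> the first relation collapses to
        \<open>N y\<^sup>2 = 1\<close>, and the second divided by \<open>y\<^sup>2\<close> is the
        condition on \<open>Re \<epsilon>\<close>.\<close>
      define \<epsilon> where "\<epsilon> = - x / of_real y"
      have "real N * y\<^sup>2 = 1"
        using diag True by (simp add: N algebra_simps)
      then have "(sqrt (real N) * y)\<^sup>2 = 1"
        by (simp add: power_mult_distrib)
      then have "sqrt (real N) * y = 1"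
        using \<open>y > 0\<close> by (subst (asm) abs_square_eq_1) simp
      then have y: "y = 1 / sqrt (real N)"
        using \<open>N > 0\<close> by (simp add: eq_divide_eq mult.commute)
      have "cmod \<epsilon> = 1"
        using True \<open>y > 0\<close> by (simp add: \<epsilon>_def norm_divide)
      moreover have "2 * real b * Re \<epsilon> = real a + real c"
      proof -
        have "y\<^sup>2 * (2 * real b * Re \<epsilon>) = y\<^sup>2 * (real a + real c)"
          using off True \<open>y > 0\<close> by (simp add: \<epsilon>_def Re_divide_of_real power2_eq_square algebra_simps)
        then show ?thesis
          using \<open>y > 0\<close> by simp
      qed
      moreover have "x = - (\<epsilon> / of_real (sqrt (real N)))"
        using \<open>y > 0\<close> \<open>N > 0\<close> by (simp add: \<epsilon>_def y)
      ultimately have "U \<in> complex_solutions a b c M"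
        unfolding complex_solutions_def U assms(1)[symmetric] using y by blast
      then show ?thesis ..
    next
      case False
      \<comment> \<open>Now \<open>x\<close> is real and equals \<open>- t y\<close>; dividing the
        second relation by \<open>y\<^sup>2\<close> gives the quadratic equation for
        \<open>t\<close>.\<close>
      define t where "t = - Re x / y"
      have x: "x = of_real (Re x)" "Re x \<noteq> 0" "(cmod x)\<^sup>2 = (Re x)\<^sup>2"
        using x False \<open>x \<noteq> 0\<close> by (auto simp: complex_eq_iff cmod_power2)
      have rx: "Re x = - (t * y)"
        using \<open>y > 0\<close> by (simp add: t_def)
      have "y\<^sup>2 * (real a * t\<^sup>2 - 2 * real b * t + real c) = 0"
        using off unfolding x(3) rx by algebra
      then have t: "real a * t\<^sup>2 - 2 * real b * t + real c = 0"
        using \<open>y > 0\<close> by simp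
      \<comment> \<open>The quadratic equation fixes the sign of \<open>t\<close>:
        \<open>2 b t\<close> equals \<open>a t\<^sup>2 + c\<close>, which is nonnegative.\<close>
      then have "2 * real b * t \<ge> 0"
        by (smt (verit) of_nat_0_le_iff zero_le_mult_iff zero_le_power2)
      then have "t \<ge> 0"
        using \<open>b > 0\<close> by (simp add: zero_le_mult_iff)
      moreover have "t \<noteq> 0"
        using x(2) rx by auto
      ultimately have "t > 0" by simp
      \<comment> \<open>Replacing \<open>a t\<^sup>2 + c\<close> by \<open>2 b t\<close> in the
        first relation completes the square.\<close>
      have "real b * (t + 1)\<^sup>2 * y\<^sup>2 = 1"
        using diag t unfolding x(3) rx by algebra
      then have "(sqrt (real b) * (t + 1) * y)\<^sup>2 = 1"
        by (simp add: power_mult_distrib)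
      then have "sqrt (real b) * (t + 1) * y = 1"
        using \<open>t > 0\<close> \<open>y > 0\<close> by (subst (asm) abs_square_eq_1) simp
      then have y: "y = 1 / (sqrt (real b) * (t + 1))"
        using \<open>b > 0\<close> \<open>t > 0\<close> by (simp add: eq_divide_eq mult.commute)
      have "x = of_real (- (t / (sqrt (real b) * (t + 1))))"
        using x(1) rx y by simp
      then have "U \<in> real_solutions a b c M"
        unfolding real_solutions_def U using y t \<open>t > 0\<close> by blast
      then show ?thesis ..
    qed
  next
    fix U assume "U \<in> real_solutions a b c M \<union> complex_solutions a b c M"
    then show "U \<in> ?crit"
    proof
      assume "U \<in> real_solutions a b c M"
      then obtain t where "t > 0" and t: "real a * t\<^sup>2 - 2 * real b * t + real c = 0"
        and U: "U = ?U (of_real (- (t / (sqrt (real b) * (t + 1))))) (1 / (sqrt (real b) * (t + 1)))"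
        by (auto simp: real_solutions_def)
      have "b > 0"
        using b_pos_real \<open>t > 0\<close> t .
      define y where "y = 1 / (sqrt (real b) * (t + 1))"
      define x where "x = complex_of_real (- (t * y))"
      have "y > 0"
        using \<open>b > 0\<close> \<open>t > 0\<close> by (simp add: y_def)
      have Uxy: "U = ?U x y"
        by (simp add: U x_def y_def)
      have y2: "real b * (t + 1)\<^sup>2 * y\<^sup>2 = 1"
        using \<open>b > 0\<close> \<open>t > 0\<close> by (simp add: y_def power_divide power_mult_distrib)
      have cx: "(cmod x)\<^sup>2 = (t * y)\<^sup>2" "Re x = - (t * y)" "Im x = 0" "x \<noteq> 0"
        using \<open>t > 0\<close> \<open>y > 0\<close> by (simp_all add: x_def cmod_power2)
      have "(real a + real b) * (cmod x)\<^sup>2 + (real b + real c) * y\<^sup>2 = 1"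
        unfolding cx using t y2 by algebra
      moreover have "real a * (cmod x)\<^sup>2 + 2 * real b * (y * Re x) + real c * y\<^sup>2 = 0"
        unfolding cx using t by algebra
      ultimately show ?thesis
        using crit_iff Uxy \<open>y > 0\<close> \<open>b > 0\<close> cx by blast
    next
      assume "U \<in> complex_solutions a b c M"
      then obtain \<epsilon> where \<epsilon>: "cmod \<epsilon> = 1" "2 * real b * Re \<epsilon> = real a + real c"
        and U: "U = ?U (- (\<epsilon> / of_real (sqrt (real N)))) (1 / sqrt (real N))"
        by (auto simp: complex_solutions_def assms(1))
      define y where "y = 1 / sqrt (real N)"
      define x where "x = - (\<epsilon> * complex_of_real y)"
      have "y > 0"
        using \<open>N > 0\<close> by (simp add: y_def)
      have Uxy: "U = ?U x y"
        by (simp add: U x_def y_def)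
      have y2: "real N * y\<^sup>2 = 1"
        using \<open>N > 0\<close> by (simp add: y_def power_divide)
      have cx: "cmod x = y" "Re x = - (Re \<epsilon> * y)" "x \<noteq> 0"
        using \<open>y > 0\<close> \<epsilon>(1) by (auto simp: x_def norm_mult)
      have "(real a + real b) * (cmod x)\<^sup>2 + (real b + real c) * y\<^sup>2 = 1"
        unfolding cx using y2 N by algebra
      moreover have "real a * (cmod x)\<^sup>2 + 2 * real b * (y * Re x) + real c * y\<^sup>2 = 0"
        unfolding cx using \<epsilon>(2) by algebra
      ultimately show ?thesis
        using crit_iff Uxy \<open>y > 0\<close> b_pos_complex[OF \<epsilon>(2)] cx by blast
    qed
  qed

  \<comment> \<open>Matrices lying in both families\<close>
  have scaled: "?U (- (1 / of_real (sqrt (real N)))) (1 / sqrt (real N))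
      = (1 / sqrt (real N)) *\<^sub>R pattern_matrix M (-1) 1"
    by (auto simp: vec_eq_iff pattern_matrix_nth[OF M]) (simp_all add: scaleR_conv_of_real)
  \<comment> \<open>Both parameters must agree. Comparing the ratios of \<open>x\<close> to
    \<open>y\<close> gives \<open>\<epsilon> = t\<close>, a positive real of modulus one, so both
    are 1.\<close>
  have common: "a + c = 2 * b \<and> U = (1 / sqrt (real N)) *\<^sub>R pattern_matrix M (-1) 1"
    if "U \<in> real_solutions a b c M \<inter> complex_solutions a b c M" for U
  proof -
    obtain t where "t > 0" and t: "real a * t\<^sup>2 - 2 * real b * t + real c = 0"
      and Ut: "U = ?U (of_real (- (t / (sqrt (real b) * (t + 1))))) (1 / (sqrt (real b) * (t + 1)))"
      using \<open>U \<in> _\<close> by (auto simp: real_solutions_def)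
    obtain \<epsilon> where \<epsilon>: "cmod \<epsilon> = 1" "2 * real b * Re \<epsilon> = real a + real c"
      and U\<epsilon>: "U = ?U (- (\<epsilon> / of_real (sqrt (real N)))) (1 / sqrt (real N))"
      using \<open>U \<in> _\<close> by (auto simp: complex_solutions_def assms(1))
    have "b > 0"
      using b_pos_real \<open>t > 0\<close> t .
    have eq: "1 / (sqrt (real b) * (t + 1)) = 1 / sqrt (real N)"
        "complex_of_real (- (t / (sqrt (real b) * (t + 1)))) = - (\<epsilon> / of_real (sqrt (real N)))"
      using Ut U\<epsilon> pattern_matrix_eq_iff[OF M card \<open>b > 0\<close>] of_real_eq_iff by metis+
    have "complex_of_real (- (t * (1 / (sqrt (real b) * (t + 1))))) = - (\<epsilon> / of_real (sqrt (real N)))"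
      using eq(2) by simp
    then have "\<epsilon> = of_real t"
      using \<open>N > 0\<close> unfolding eq(1) by simp
    with \<epsilon>(1) \<open>t > 0\<close> have "\<epsilon> = 1"
      by simp
    moreover from this have "real (a + c) = real (2 * b)"
      using \<epsilon>(2) by simp
    ultimately show ?thesis
      using U\<epsilon> scaled by (metis of_nat_eq_iff)
  qed
  show "real_solutions a b c M \<inter> complex_solutions a b c M \<noteq> {} \<longrightarrow>
      a + c = 2 * b \<and> 2 * real b = real N / 2 \<and> hadamard_matrix (pattern_matrix M (-1) 1)"
  proof
    assume "real_solutions a b c M \<inter> complex_solutions a b c M \<noteq> {}"
    then have ac: "a + c = 2 * b"
      using common by blast
    then have r: "real a + real c = 2 * real b"
      by (metis of_nat_add of_nat_mult of_nat_numeral)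
    \<comment> \<open>At \<open>x = -1\<close>, \<open>y = 1\<close> the entries are real and the
      inner product of distinct rows is \<open>a - 2 b + c\<close>.\<close>
    have "(\<Sum>k\<in>UNIV. pattern_matrix M (-1) 1 $ i $ k * pattern_matrix M (-1) 1 $ j $ k) = 0"
      if "i \<noteq> j" for i j
    proof -
      have "cnj (pattern_matrix M (-1) 1 $ j $ k) = pattern_matrix M (-1) 1 $ j $ k" for k
        by (simp add: pattern_matrix_nth[OF M])
      moreover have "2 * complex_of_nat b = of_nat a + of_nat c"
        using ac by (metis of_nat_add of_nat_mult of_nat_numeral)
      ultimately show ?thesis
        using pattern_matrix_rows[OF M card, of "-1" 1 i j] that by simp
    qed
    then have "hadamard_matrix (pattern_matrix M (-1) 1)"
      by (simp add: hadamard_matrix_def pattern_matrix_nth[OF M])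
    then show "a + c = 2 * b \<and> 2 * real b = real N / 2 \<and> hadamard_matrix (pattern_matrix M (-1) 1)"
      using ac r N by simp
  qed
  show "a + c = 2 * b \<and> 2 * real b = real N / 2 \<and> hadamard_matrix (pattern_matrix M (-1) 1) \<longrightarrow>
      real_solutions a b c M \<inter> complex_solutions a b c M
        = {(1 / sqrt (real N)) *\<^sub>R pattern_matrix M (-1) 1}"
  proof (intro impI, elim conjE)
    assume ac: "a + c = 2 * b" and Nb: "2 * real b = real N / 2"
    have r: "real a + real c = 2 * real b"
      using ac by (metis of_nat_add of_nat_mult of_nat_numeral)
    \<comment> \<open>Here \<open>N = 4 b\<close>, so the real solution with \<open>t = 1\<close>
      and the complex one with \<open>\<epsilon> = 1\<close> are the same matrix.\<close>
    have "sqrt (real N) = sqrt (real b) * (1 + 1)"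
      using real_sqrt_mult[of 4 "real b"] Nb by simp
    then have "(1 / sqrt (real N)) *\<^sub>R pattern_matrix M (-1) 1 \<in> real_solutions a b c M"
      unfolding real_solutions_def scaled[symmetric] using r
      by (intro CollectI exI[of _ 1]) simp
    moreover have "(1 / sqrt (real N)) *\<^sub>R pattern_matrix M (-1) 1 \<in> complex_solutions a b c M"
      unfolding complex_solutions_def scaled[symmetric] assms(1)[symmetric] using r
      by (intro CollectI exI[of _ 1]) simp
    ultimately show "real_solutions a b c M \<inter> complex_solutions a b c M
        = {(1 / sqrt (real N)) *\<^sub>R pattern_matrix M (-1) 1}"
      using common by blast
  qed
qed

end
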